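(* Let $V$ be a $*$-locally convex space and let $\{K_n\}$ be an $L^1$-matrix convex set in $V$ such that $M_n(V)^+:=\bigcup_{r=1}^\infty rK_n$ is a cone in $M_n(V)_{sa}$ for all $n$ and $V^+:=M_1(V)^+$ is proper and generating. Suppose that $\{K_n\}$ is a regularly embedded $L^1$-matricial cap in $V$. Then $A_0(K_1,V)$ has an order unit $e$ such that $(A_0(K_1,V),\{M_n(A_0(K_1,V))^+\},e)$ is a matrix order unit space.
   Context: A $*$-locally convex space is a (Hausdorff) complex locally convex space $V$ with an involution $*$ that is a homeomorphism; $M_n(V)$ has the product topology and involution $[v_{ij}]^*=[v_{ji}^*]$; $V_{sa}$ denotes self-adjoint elements. A cone is a subset of the self-adjoint part closed under addition and multiplication by nonnegative reals; it is proper if $C\cap(-C)=\{0\}$ and generating if it spans the whole space. For a compact convex set $K$ with $0$ an extreme point of $K$, $\operatorname{lead}(K)$ is the set of $k\in K$ such that whenever $k=\alpha k_1$ with $k_1\in K$, $\alpha\in[0,1]$, then $\alpha=1$. A collection $\{K_n\}$ of compact convex sets $K_n\subseteq M_n(V)_{sa}$ with $0$ an extreme point of each $K_n$ is an $L^1$-matrix convex set if: (L1) if $u\in K_n$ and $\gamma_i$ are complex $n\times n_i$ matrices with $\sum_{i=1}^k\gamma_i\gamma_i^*\le I_n$, then $\bigoplus_{i=1}^k\gamma_i^*u\gamma_i\in K_{\sum n_i}$; (L2) if $u=\begin{bmatrix}u_{11}&u_{12}\\ u_{12}^*&u_{22}\end{bmatrix}\in K_{2n}$ with $u_{11},u_{22}\in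 K_n$, $u_{12}\in M_n(V)$, then $u_{12}+u_{12}^*\in\operatorname{co}(K_n\cup-K_n)$; (L3) if $u=\begin{bmatrix}u_{11}&u_{12}\\ u_{12}^*&u_{22}\end{bmatrix}\in K_{m+n}$ with $u_{11}\in K_m$, $u_{22}\in K_n$, $u_{12}\in M_{m,n}(V)$, and $u_{11}=\alpha_1\widehat{u_{11}}$, $u_{22}=\alpha_2\widehat{u_{22}}$ with $\alpha_1,\alpha_2\in[0,1]$, $\widehat{u_{11}}\in\operatorname{lead}(K_m)$, $\widehat{u_{22}}\in\operatorname{lead}(K_n)$, then $\alpha_1+\alpha_2\le1$. Put $L_n=\operatorname{lead}(K_n)$. $\{K_n\}$ is an $L^1$-matricial cap of $V$ if (1) $L_1$ is convex; and (2) whenever $v=\begin{bmatrix}v_{11}&v_{12}\\ v_{12}^*&v_{22}\end{bmatrix}\in L_{m+n}$ with $v_{11}\in K_m$, $v_{22}\in K_n$, $v_{12}\in M_{m,n}(V)$ and $v_{11}=\alpha_1\widehat{v_1}$, $v_{22}=\alpha_2\widehat{v_2}$ with $\widehat{v_1}\in L_m$, $\widehat{v_2}\in L_n$, $\alpha_1,\alpha_2\in[0,1]$, then $\alpha_1+\alpha_2=1$. When $L_1$ is compact and convex, $A(L_1)_{sa}$ is the Banach space (sup norm) of real-valued continuous affine functions on $L_1$. $\{K_n\}$ is regularly embedded in $V$ if (1) $L_1$ is compact and convex; and (2) the map $\chi:V_{sa}\to(A(L_1)_{sa}^* )_{w^*}$ (the Banach dual with its $w^*$-topology) is a linear homeomorphism,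 where $\chi(w)(a)=\lambda a(u)-\mu a(v)$ for $a\in A(L_1)_{sa}$ if $w=\lambda u-\mu v$ with $u,v\in L_1$, $\lambda,\mu\ge0$ ($\chi$ is well defined). $A_0(K_1,V)$ is the space of continuous affine $a:K_1\to\mathbb{C}$ with $a(0)=0$ that extend to a continuous linear functional $\tilde a:V\to\mathbb{C}$ (the extension is unique), with involution $a^*(u)=\overline{a(u)}$, $u\in K_1$. $M_n(A_0(K_1,V))$ has involution $[a_{ij}]^*=[a_{ji}^*]$, and $M_n(A_0(K_1,V))^+$ is the set of self-adjoint $[a_{ij}]$ with $\sum_{i,j}\widetilde{a_{ij}}(v_{ij})\ge0$ for all $[v_{ij}]\in K_n$. A complex $*$-vector space $W$ is matrix ordered if each $M_n(W)_{sa}$ carries a cone $M_n(W)^+$ with $\gamma^*M_m(W)^+\gamma\subseteq M_n(W)^+$ for all scalar $m\times n$ matrices $\gamma$. An element $e\in W^+=M_1(W)^+$ is an order unit if for each $w\in W_{sa}$ there is $t>0$ with $-te\le w\le te$. The cone $M_n(W)^+$ is Archimedean if, for $v_0\in M_n(W)^+$ and $v\in M_n(W)_{sa}$, $-tv_0\le v$ for all $t>0$ implies $v\in M_n(W)^+$. A matrix order unit space is a matrix ordered space $W$ with an order unit $e$ such that $W^+$ is proper and $M_n(W)^+$ is Archimedean for each $n$. *)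

theory Defs
  imports "HOL-Analysis.Analysis" "HOL-Library.Function_Algebras"
begin

section \<open>Pointwise vector space structure on functions\<close>

instantiation "fun" :: (type, real_vector) real_vector
begin

definition scaleR_fun_def: "r *\<^sub>R f = (\<lambda>x. r *\<^sub>R f x)"

instance
  by standard (simp_all add: scaleR_fun_def fun_eq_iff scaleR_add_right scaleR_add_left)

end

section \<open>Complex vector spaces with involution and star-locally convex spaces\<close>

class star_vector = real_vector +
  fixes scaleC :: "complex \<Rightarrow> 'a \<Rightarrow> 'a"  (infixr \<open>*\<^sub>C\<close> 75)
    and star :: "'a \<Rightarrow> 'a"
  assumes scaleC_add_right: "c *\<^sub>C (x + y) = c *\<^sub>C x + c *\<^sub>C y"
    and scaleC_add_left: "(c + d) *\<^sub>C x = c *\<^sub>C x + d *\<^sub>C x"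
    and scaleC_scaleC: "c *\<^sub>C d *\<^sub>C x = (c * d) *\<^sub>C x"
    and scaleC_one: "1 *\<^sub>C x = x"
    and scaleR_scaleC: "r *\<^sub>R x = complex_of_real r *\<^sub>C x"
    and star_add: "star (x + y) = star x + star y"
    and star_scaleC: "star (c *\<^sub>C x) = cnj c *\<^sub>C star x"
    and star_star: "star (star x) = x"

instantiation complex :: star_vector
begin

definition scaleC_complex_def: "c *\<^sub>C (z :: complex) = c * z"
definition star_complex_def: "star (z :: complex) = cnj z"

instance
  by standard
    (simp_all add: scaleC_complex_def star_complex_def algebra_simps scaleR_conv_of_real)

end

text \<open>For scalar-valued functions the following is \<open>star a u = cnj (a u)\<close>. On matrices, which
  are functions of two indices, it is \<^emph>\<open>not\<close> the matrix involution: that is \<open>mstar\<close> below.\<close>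

instantiation "fun" :: (type, star_vector) star_vector
begin

definition scaleC_fun_def: "c *\<^sub>C f = (\<lambda>x. c *\<^sub>C f x)"
definition star_fun_def: "star f = (\<lambda>x. star (f x))"

instance
  by standard
    (simp_all add: scaleC_fun_def star_fun_def scaleR_fun_def fun_eq_iff scaleC_add_right
      scaleC_add_left scaleC_scaleC scaleC_one scaleR_scaleC star_add star_scaleC star_star)

end

text \<open>Joint continuity of scalar multiplication, local convexity and continuity of the involution
  (which is its own inverse, hence a homeomorphism) are written out, since the class
  specification cannot refer to \<open>continuous_on\<close> and \<open>convex\<close>.\<close>

class star_locally_convex = star_vector + topological_ab_group_add + t2_space +
  assumes tendsto_scaleC_Pair:
      "filterlim (\<lambda>p. fst p *\<^sub>C snd p) (nhds (c *\<^sub>C x)) (nhds c \<times>\<^sub>F nhds x)"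
    and locally_convex: "open U \<Longrightarrow> 0 \<in> U \<Longrightarrow> \<exists>C. open C \<and> 0 \<in> C \<and> C \<subseteq> U \<and>
      (\<forall>x\<in>C. \<forall>y\<in>C. \<forall>u\<ge>0. \<forall>v\<ge>0. u + v = 1 \<longrightarrow> u *\<^sub>R x + v *\<^sub>R y \<in> C)"
    and tendsto_star: "filterlim star (nhds (star x)) (nhds x)"

lemma star_locally_convex_library_form:
  shows "continuous_on UNIV (\<lambda>p. fst p *\<^sub>C (snd p :: 'v::star_locally_convex))"
    and "open U \<Longrightarrow> (0 :: 'v) \<in> U \<Longrightarrow> \<exists>C. open C \<and> convex C \<and> 0 \<in> C \<and> C \<subseteq> U"
    and "homeomorphism UNIV UNIV star (star :: 'v \<Rightarrow> 'v)"
proof -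
  show "continuous_on UNIV (\<lambda>p. fst p *\<^sub>C (snd p :: 'v))"
    unfolding continuous_on_def
  proof
    fix p :: "complex \<times> 'v"
    show "((\<lambda>p. fst p *\<^sub>C snd p) \<longlongrightarrow> fst p *\<^sub>C snd p) (at p within UNIV)"
      using tendsto_scaleC_Pair[of "fst p" "snd p"]
      by (auto simp: nhds_prod[symmetric] intro: tendsto_mono[OF at_le] filterlim_mono simp: at_within_def)
  qed
  show "open U \<Longrightarrow> (0 :: 'v) \<in> U \<Longrightarrow> \<exists>C. open C \<and> convex C \<and> 0 \<in> C \<and> C \<subseteq> U"
    using locally_convex[of U] unfolding convex_def by blast
  have "continuous_on UNIV (star :: 'v \<Rightarrow> 'v)"
    unfolding continuous_on_def
    by (auto simp: at_within_def intro: filterlim_mono[OF tendsto_star])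
  then show "homeomorphism UNIV UNIV star (star :: 'v \<Rightarrow> 'v)"
    by (metis UNIV_I homeomorphismI image_subset_iff star_star)
qed

section \<open>Matrices\<close>

text \<open>An \<open>m \<times> n\<close> matrix is a function of two indices (counted from 0) that vanishes
  outside \<open>{..<m} \<times> {..<n}\<close>. The topology of the function space \<open>nat \<Rightarrow> nat \<Rightarrow> 'a\<close> is the
  product topology, so it induces the product topology on each set of matrices; likewise
  for the vector space structure.\<close>

definition mats :: "'a::zero set \<Rightarrow> nat \<Rightarrow> nat \<Rightarrow> (nat \<Rightarrow> nat \<Rightarrow> 'a) set" where
  "mats W m n = {v. (\<forall>i<m. \<forall>j<n. v i j \<in> W) \<and> (\<forall>i j. i \<ge> m \<or> j \<ge> n \<longrightarrow> v i j = 0)}"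

definition mstar :: "(nat \<Rightarrow> nat \<Rightarrow> 'a::star_vector) \<Rightarrow> nat \<Rightarrow> nat \<Rightarrow> 'a" where
  "mstar v = (\<lambda>i j. star (v j i))"

definition sa :: "'a::star_vector set \<Rightarrow> 'a set" where
  "sa W = {w \<in> W. star w = w}"

definition mats_sa :: "'a::star_vector set \<Rightarrow> nat \<Rightarrow> (nat \<Rightarrow> nat \<Rightarrow> 'a) set" where
  "mats_sa W n = {v \<in> mats W n n. mstar v = v}"

text \<open>\<open>compress n \<gamma> u\<close> is \<open>\<gamma>\<^sup>* u \<gamma>\<close> for an \<open>n \<times> n\<close> matrix \<open>u\<close> and a scalar matrix \<open>\<gamma>\<close> with
  \<open>n\<close> rows.\<close>

definition compress ::
  "nat \<Rightarrow> (nat \<Rightarrow> nat \<Rightarrow> complex) \<Rightarrow> (nat \<Rightarrow> nat \<Rightarrow> 'a::star_vector) \<Rightarrow> nat \<Rightarrow> nat \<Rightarrow> 'a" where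
  "compress n \<gamma> u = (\<lambda>i j. \<Sum>k<n. \<Sum>l<n. (cnj (\<gamma> k i) * \<gamma> l j) *\<^sub>C u k l)"

text \<open>The block matrix with upper left corner \<open>a\<close> of size \<open>m \<times> m\<close>.\<close>

definition block :: "nat \<Rightarrow> (nat \<Rightarrow> nat \<Rightarrow> 'a) \<Rightarrow> (nat \<Rightarrow> nat \<Rightarrow> 'a) \<Rightarrow> (nat \<Rightarrow> nat \<Rightarrow> 'a) \<Rightarrow>
    (nat \<Rightarrow> nat \<Rightarrow> 'a) \<Rightarrow> nat \<Rightarrow> nat \<Rightarrow> 'a" where
  "block m a b c d = (\<lambda>i j.
     if i < m then (if j < m then a i j else b i (j - m))
     else (if j < m then c (i - m) j else d (i - m) (j - m)))"

text \<open>\<open>direct_sum N u k\<close> is the block diagonal sum of \<open>u 0, \<dots>, u (k - 1)\<close>, where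
  \<open>u i\<close> has size \<open>N i \<times> N i\<close>.\<close>

primrec direct_sum ::
  "(nat \<Rightarrow> nat) \<Rightarrow> (nat \<Rightarrow> nat \<Rightarrow> nat \<Rightarrow> 'a::zero) \<Rightarrow> nat \<Rightarrow> nat \<Rightarrow> nat \<Rightarrow> 'a" where
  "direct_sum N u 0 = (\<lambda>i j. 0)"
| "direct_sum N u (Suc k) =
     block (\<Sum>i<k. N i) (direct_sum N u k) (\<lambda>i j. 0) (\<lambda>i j. 0) (u k)"

definition psd :: "nat \<Rightarrow> (nat \<Rightarrow> nat \<Rightarrow> complex) \<Rightarrow> bool" where
  "psd n A \<longleftrightarrow> (\<forall>x. (\<Sum>i<n. \<Sum>j<n. cnj (x i) * A i j * x j) \<in> \<real>\<^sub>\<ge>\<^sub>0)"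

text \<open>\<open>row_contraction n k N \<gamma>\<close> says \<open>\<Sum>s<k. \<gamma> s (\<gamma> s)\<^sup>* \<le> I\<^sub>n\<close>, where \<open>\<gamma> s\<close> has size \<open>n \<times> N s\<close>.\<close>

definition row_contraction ::
  "nat \<Rightarrow> nat \<Rightarrow> (nat \<Rightarrow> nat) \<Rightarrow> (nat \<Rightarrow> nat \<Rightarrow> nat \<Rightarrow> complex) \<Rightarrow> bool" where
  "row_contraction n k N \<gamma> \<longleftrightarrow>
     psd n (\<lambda>i j. (if i = j then 1 else 0) - (\<Sum>s<k. \<Sum>l<N s. \<gamma> s i l * cnj (\<gamma> s j l)))"

section \<open>Cones\<close>

definition cone_in :: "'a::real_vector set \<Rightarrow> 'a set \<Rightarrow> bool" where
  "cone_in S C \<longleftrightarrow> C \<subseteq> S \<and> C \<noteq> {} \<and>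
     (\<forall>x\<in>C. \<forall>y\<in>C. x + y \<in> C) \<and> (\<forall>x\<in>C. \<forall>t\<ge>0. t *\<^sub>R x \<in> C)"

definition proper_cone :: "'a::real_vector set \<Rightarrow> bool" where
  "proper_cone C \<longleftrightarrow> C \<inter> uminus ` C = {0}"

definition generating :: "'a::star_vector set \<Rightarrow> bool" where
  "generating C \<longleftrightarrow> module.span scaleC C = UNIV"

section \<open>\<open>L\<^sup>1\<close>-matrix convex sets and matricial caps\<close>

definition lead :: "'a::real_vector set \<Rightarrow> 'a set" where
  "lead K = {k \<in> K. \<forall>k1\<in>K. \<forall>\<alpha>\<in>{0..1}. k = \<alpha> *\<^sub>R k1 \<longrightarrow> \<alpha> = 1}"

text \<open>The identification of \<open>1 \<times> 1\<close> matrices with their entry.\<close>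

definition entries1 :: "(nat \<Rightarrow> nat \<Rightarrow> 'a) set \<Rightarrow> 'a set" where
  "entries1 C = (\<lambda>u. u 0 0) ` C"

text \<open>The families below are indexed by the positive integers; the value at 0 is irrelevant.\<close>

definition L1_matrix_convex :: "(nat \<Rightarrow> (nat \<Rightarrow> nat \<Rightarrow> 'v::star_locally_convex) set) \<Rightarrow> bool" where
  "L1_matrix_convex K \<longleftrightarrow>
     (\<forall>n\<ge>1. K n \<subseteq> mats_sa UNIV n \<and> compact (K n) \<and> convex (K n) \<and> 0 extreme_point_of K n) \<and>
     (\<forall>n\<ge>1. \<forall>k\<ge>1. \<forall>N \<gamma>. \<forall>u\<in>K n.
        (\<forall>i<k. N i \<ge> 1 \<and> \<gamma> i \<in> mats UNIV n (N i)) \<and> row_contraction n k N \<gamma> \<longrightarrow>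
        direct_sum N (\<lambda>i. compress n (\<gamma> i) u) k \<in> K (\<Sum>i<k. N i)) \<and>
     (\<forall>n\<ge>1. \<forall>u11\<in>K n. \<forall>u22\<in>K n. \<forall>u12\<in>mats UNIV n n.
        block n u11 u12 (mstar u12) u22 \<in> K (2 * n) \<longrightarrow>
        u12 + mstar u12 \<in> convex hull (K n \<union> uminus ` K n)) \<and>
     (\<forall>m\<ge>1. \<forall>n\<ge>1. \<forall>u11\<in>K m. \<forall>u22\<in>K n. \<forall>u12\<in>mats UNIV m n.
        \<forall>\<alpha>1\<in>{0..1}. \<forall>\<alpha>2\<in>{0..1}. \<forall>w1\<in>lead (K m). \<forall>w2\<in>lead (K n).
        block m u11 u12 (mstar u12) u22 \<in> K (m + n) \<and>
        u11 = \<alpha>1 *\<^sub>R w1 \<and> u22 = \<alpha>2 *\<^sub>R w2 \<longrightarrow> \<alpha>1 + \<alpha>2 \<le> 1)"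

definition L1_matricial_cap :: "(nat \<Rightarrow> (nat \<Rightarrow> nat \<Rightarrow> 'v::star_locally_convex) set) \<Rightarrow> bool" where
  "L1_matricial_cap K \<longleftrightarrow>
     convex (lead (entries1 (K 1))) \<and>
     (\<forall>m\<ge>1. \<forall>n\<ge>1. \<forall>v11\<in>K m. \<forall>v22\<in>K n. \<forall>v12\<in>mats UNIV m n.
        \<forall>\<alpha>1\<in>{0..1}. \<forall>\<alpha>2\<in>{0..1}. \<forall>w1\<in>lead (K m). \<forall>w2\<in>lead (K n).
        block m v11 v12 (mstar v12) v22 \<in> lead (K (m + n)) \<and>
        v11 = \<alpha>1 *\<^sub>R w1 \<and> v22 = \<alpha>2 *\<^sub>R w2 \<longrightarrow> \<alpha>1 + \<alpha>2 = 1)"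

definition cap_cone :: "(nat \<Rightarrow> (nat \<Rightarrow> nat \<Rightarrow> 'v::star_vector) set) \<Rightarrow> nat \<Rightarrow>
    (nat \<Rightarrow> nat \<Rightarrow> 'v) set" where
  "cap_cone K n = (\<Union>r\<in>{1::nat..}. (\<lambda>u. real r *\<^sub>R u) ` K n)"

section \<open>Regular embedding\<close>

definition affine_map_on :: "'a::real_vector set \<Rightarrow> ('a \<Rightarrow> 'b::real_vector) \<Rightarrow> bool" where
  "affine_map_on S f \<longleftrightarrow> (\<forall>x\<in>S. \<forall>y\<in>S. \<forall>t\<in>{0..1}.
     f ((1 - t) *\<^sub>R x + t *\<^sub>R y) = (1 - t) *\<^sub>R f x + t *\<^sub>R f y)"

text \<open>Functions with domain a set are represented by their extensions by 0, so that
  the sets of functions below are linear subspaces of full function spaces.\<close>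

definition aff_sa :: "'v::star_locally_convex set \<Rightarrow> ('v \<Rightarrow> real) set" where
  "aff_sa L = {a. continuous_on L a \<and> affine_map_on L a \<and> (\<forall>x. x \<notin> L \<longrightarrow> a x = 0)}"

text \<open>The Banach dual of \<open>aff_sa L\<close> under the supremum norm. Its \<open>w\<^sup>*\<close>-topology is that of
  pointwise convergence on \<open>aff_sa L\<close>, which is the subspace topology inherited
  from the (product) topology of the function space \<open>('v \<Rightarrow> real) \<Rightarrow> real\<close>.\<close>

definition aff_dual :: "'v::star_locally_convex set \<Rightarrow> (('v \<Rightarrow> real) \<Rightarrow> real) set" where
  "aff_dual L = {\<phi>.
     (\<forall>a\<in>aff_sa L. \<forall>b\<in>aff_sa L. \<phi> (a + b) = \<phi> a + \<phi> b) \<and>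
     (\<forall>a\<in>aff_sa L. \<forall>t. \<phi> (t *\<^sub>R a) = t * \<phi> a) \<and>
     (\<exists>B. \<forall>a\<in>aff_sa L. \<bar>\<phi> a\<bar> \<le> B * (SUP x\<in>L. \<bar>a x\<bar>)) \<and>
     (\<forall>a. a \<notin> aff_sa L \<longrightarrow> \<phi> a = 0)}"

text \<open>When \<open>V\<^sup>+\<close> is generating and \<open>L\<close> is nonempty, every element of \<open>V\<^sub>s\<^sub>a\<close> has the form
  \<open>s u - t v\<close> with \<open>u, v \<in> L\<close> and \<open>s, t \<ge> 0\<close>, so the formula determines \<open>chi\<close> on \<open>V\<^sub>s\<^sub>a\<close>. If \<open>L\<close>
  is empty then \<open>V = {0}\<close> and \<open>chi 0 = 0\<close> by linearity.\<close>

definition regularly_embedded :: "(nat \<Rightarrow> (nat \<Rightarrow> nat \<Rightarrow> 'v::star_locally_convex) set) \<Rightarrow> bool" where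
  "regularly_embedded K \<longleftrightarrow> (let L = lead (entries1 (K 1)); Vsa = sa (UNIV :: 'v set) in
     compact L \<and> convex L \<and>
     (\<exists>chi. (\<forall>u\<in>L. \<forall>v\<in>L. \<forall>s\<ge>0. \<forall>t\<ge>0. \<forall>a\<in>aff_sa L.
             chi (s *\<^sub>R u - t *\<^sub>R v) a = s * a u - t * a v) \<and>
          (\<forall>x\<in>Vsa. \<forall>y\<in>Vsa. chi (x + y) = chi x + chi y) \<and>
          (\<forall>x\<in>Vsa. \<forall>t. chi (t *\<^sub>R x) = t *\<^sub>R chi x) \<and>
          homeomorphic_map (top_of_set Vsa) (top_of_set (aff_dual L)) chi))"

section \<open>The space \<open>A\<^sub>0(K\<^sub>1, V)\<close>\<close>

definition linear_extension ::
  "'v::star_locally_convex set \<Rightarrow> ('v \<Rightarrow> complex) \<Rightarrow> ('v \<Rightarrow> complex) \<Rightarrow> bool" where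
  "linear_extension S a f \<longleftrightarrow>
     Vector_Spaces.linear scaleC scaleC f \<and> continuous_on UNIV f \<and> (\<forall>x\<in>S. f x = a x)"

definition A0 :: "(nat \<Rightarrow> (nat \<Rightarrow> nat \<Rightarrow> 'v::star_locally_convex) set) \<Rightarrow> ('v \<Rightarrow> complex) set" where
  "A0 K = (let K1 = entries1 (K 1) in
     {a. continuous_on K1 a \<and> affine_map_on K1 a \<and> a 0 = 0 \<and>
         (\<exists>f. linear_extension K1 a f) \<and> (\<forall>x. x \<notin> K1 \<longrightarrow> a x = 0)})"

text \<open>The extension is unique when \<open>K\<^sub>1\<close> spans \<open>V\<close>.\<close>

definition ext :: "(nat \<Rightarrow> (nat \<Rightarrow> nat \<Rightarrow> 'v::star_locally_convex) set) \<Rightarrow>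
    ('v \<Rightarrow> complex) \<Rightarrow> 'v \<Rightarrow> complex" where
  "ext K a = (THE f. linear_extension (entries1 (K 1)) a f)"

definition A0_cone :: "(nat \<Rightarrow> (nat \<Rightarrow> nat \<Rightarrow> 'v::star_locally_convex) set) \<Rightarrow> nat \<Rightarrow>
    (nat \<Rightarrow> nat \<Rightarrow> 'v \<Rightarrow> complex) set" where
  "A0_cone K n = {a \<in> mats_sa (A0 K) n.
     \<forall>v\<in>K n. (\<Sum>i<n. \<Sum>j<n. ext K (a i j) (v i j)) \<in> \<real>\<^sub>\<ge>\<^sub>0}"

section \<open>Matrix order unit spaces\<close>

definition star_subspace :: "'w::star_vector set \<Rightarrow> bool" where
  "star_subspace W \<longleftrightarrow> module.subspace scaleC W \<and> star ` W \<subseteq> W"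

definition matrix_ordered ::
  "'w::star_vector set \<Rightarrow> (nat \<Rightarrow> (nat \<Rightarrow> nat \<Rightarrow> 'w) set) \<Rightarrow> bool" where
  "matrix_ordered W C \<longleftrightarrow> star_subspace W \<and>
     (\<forall>n\<ge>1. cone_in (mats_sa W n) (C n)) \<and>
     (\<forall>m\<ge>1. \<forall>n\<ge>1. \<forall>\<gamma>\<in>mats UNIV m n. compress m \<gamma> ` C m \<subseteq> C n)"

definition order_unit :: "'w::star_vector set \<Rightarrow> 'w set \<Rightarrow> 'w \<Rightarrow> bool" where
  "order_unit W P e \<longleftrightarrow> e \<in> P \<and>
     (\<forall>w\<in>sa W. \<exists>t>0. w - (- t *\<^sub>R e) \<in> P \<and> t *\<^sub>R e - w \<in> P)"

definition archimedean_cone :: "'a::real_vector set \<Rightarrow> 'a set \<Rightarrow> bool" where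
  "archimedean_cone S P \<longleftrightarrow>
     (\<forall>v0\<in>P. \<forall>v\<in>S. (\<forall>t>0. v - (- t *\<^sub>R v0) \<in> P) \<longrightarrow> v \<in> P)"

definition matrix_order_unit_space ::
  "'w::star_vector set \<Rightarrow> (nat \<Rightarrow> (nat \<Rightarrow> nat \<Rightarrow> 'w) set) \<Rightarrow> 'w \<Rightarrow> bool" where
  "matrix_order_unit_space W C e \<longleftrightarrow>
     matrix_ordered W C \<and> order_unit W (entries1 (C 1)) e \<and> proper_cone (entries1 (C 1)) \<and>
     (\<forall>n\<ge>1. archimedean_cone (mats_sa W n) (C n))"

end

theory Submission
  imports Defs
begin

text \<open>
  Since the cone \<open>V\<^sup>+\<close> is generating, \<open>K\<^sub>1\<close> spans \<open>V\<close>. Hence an element of \<open>A\<^sub>0(K\<^sub>1, V)\<close> has only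
  one continuous linear extension to \<open>V\<close>, the extension depends linearly on the element, and
  \<open>(a, v) \<mapsto> \<Sum>\<^sub>i\<^sub>j ext a\<^sub>i\<^sub>j (v\<^sub>i\<^sub>j)\<close> is a bilinear pairing of \<open>M\<^sub>n(A\<^sub>0(K\<^sub>1, V))\<close> with \<open>M\<^sub>n(V)\<close>. The cone
  \<open>M\<^sub>n(A\<^sub>0(K\<^sub>1, V))\<^sup>+\<close> is the polar of \<open>K\<^sub>n\<close> for this pairing, so it is an Archimedean cone because
  the nonnegative reals are closed. In degree one it consists of the functions that are
  nonnegative on \<open>K\<^sub>1\<close>, which makes it proper.

  For the matrix order, compression by \<open>\<gamma>\<close> on the function side is adjoint to compression by the
  transpose of \<open>\<gamma>\<close> on the side of \<open>V\<close> (\<open>pairing_compress\<close>). A positive multiple of any scalar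
  matrix is a row contraction (\<open>row_contraction_scaled\<close>), so the first axiom of \<open>L\<^sup>1\<close>-matrix
  convexity, with a single summand, moves \<open>K\<^sub>n\<close> into a multiple of \<open>K\<^sub>m\<close>, and polars do not see
  positive multiples.

  The order unit \<open>e\<close> should be the function equal to 1 on \<open>L = lead K\<^sub>1\<close>. Regular embedding provides
  it: the constant 1 belongs to \<open>A(L)\<^sub>s\<^sub>a\<close>, and evaluating \<open>\<chi>(x)\<close> at it is a real-linear
  \<open>w\<^sup>*\<close>-continuous functional of \<open>x \<in> V\<^sub>s\<^sub>a\<close>, which complexifies to \<open>V\<close>
  (\<open>regularly_embedded_unit_functional\<close>). By compactness each nonzero point of \<open>K\<^sub>1\<close> has the form
  \<open>\<alpha> y\<close> with \<open>y \<in> L\<close> and \<open>0 \<le> \<alpha> \<le> 1\<close> (\<open>compact_multiple_of_lead\<close>). There \<open>e\<close> has value \<open>\<alpha>\<close>, while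
  a self-adjoint \<open>w\<close> bounded by \<open>t\<close> on \<open>K\<^sub>1\<close> has a value between \<open>- t \<alpha>\<close> and \<open>t \<alpha>\<close>; hence
  \<open>- t e \<le> w \<le> t e\<close> (\<open>order_unit_if_one_on_lead\<close>).
\<close>

section \<open>Complex-linear maps on star vector spaces\<close>

interpretation scaleC: vector_space "scaleC :: complex \<Rightarrow> 'a::star_vector \<Rightarrow> 'a"
  by standard (simp_all add: scaleC_add_right scaleC_add_left scaleC_scaleC scaleC_one)

lemma clinear_iff:
  fixes f :: "'a::star_vector \<Rightarrow> 'b::star_vector"
  shows "Vector_Spaces.linear scaleC scaleC f \<longleftrightarrow>
    (\<forall>x y. f (x + y) = f x + f y) \<and> (\<forall>c x. f (c *\<^sub>C x) = c *\<^sub>C f x)"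
  unfolding Vector_Spaces.linear_iff by (simp add: scaleC.vector_space_axioms)

lemma clinear_eq_if_eq_on_spanning_set:
  fixes f g :: "'a::star_vector \<Rightarrow> 'b::star_vector"
  assumes "Vector_Spaces.linear scaleC scaleC f" "Vector_Spaces.linear scaleC scaleC g"
    and "module.span scaleC S = UNIV" "\<And>x. x \<in> S \<Longrightarrow> f x = g x"
  shows "f = g"
proof
  interpret vector_space_pair "scaleC :: complex \<Rightarrow> 'a \<Rightarrow> 'a" "scaleC :: complex \<Rightarrow> 'b \<Rightarrow> 'b" ..
  show "f x = g x" for x
    using linear_eq_on_span[OF assms(1,2), of S x] assms(3,4) by simp
qed

lemma continuous_on_scaleC:
  fixes g :: "'a::topological_space \<Rightarrow> 'v::star_locally_convex"
  assumes "continuous_on S f" "continuous_on S g"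
  shows "continuous_on S (\<lambda>x. f x *\<^sub>C g x)"
  using continuous_on_compose2[OF star_locally_convex_library_form(1)
      continuous_on_Pair[OF assms]] by simp

lemma continuous_on_star: "continuous_on S (star :: 'v::star_locally_convex \<Rightarrow> 'v)"
  by (rule continuous_on_subset[OF homeomorphism_cont1[OF star_locally_convex_library_form(3)]]) simp

lemma star_zero [simp]: "star 0 = (0::'a::star_vector)"
  using star_add[of "0::'a" 0] by simp

lemma star_sum: "star (sum f A) = (\<Sum>x\<in>A. star (f x :: 'a::star_vector))"
  by (induction A rule: infinite_finite_induct) (simp_all add: star_add)

lemma star_minus: "star (- x) = - star (x::'a::star_vector)"
  by (rule minus_unique[symmetric]) (simp flip: star_add)

lemma star_diff: "star (x - y) = star x - star (y::'a::star_vector)"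
  using star_add[of x "- y"] by (simp add: star_minus)

definition real_part :: "'a::star_vector \<Rightarrow> 'a" where
  "real_part x = (1/2) *\<^sub>C (x + star x)"

definition imag_part :: "'a::star_vector \<Rightarrow> 'a" where
  "imag_part x = (- \<i>/2) *\<^sub>C (x - star x)"

lemma real_part_in_sa: "real_part x \<in> sa UNIV"
  by (simp add: sa_def real_part_def star_scaleC star_add star_star add.commute)

lemma imag_part_in_sa: "imag_part x \<in> sa UNIV"
proof -
  have "star (imag_part x) = (\<i>/2) *\<^sub>C (star x - x)"
    by (simp add: imag_part_def star_scaleC star_diff star_star star_minus)
  also have "\<dots> = imag_part x"
    unfolding imag_part_def by (simp add: scaleC.scale_right_diff_distrib)
  finally show ?thesis by (simp add: sa_def)
qed

lemma real_part_scaleC: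
  "real_part (c *\<^sub>C x) = Re c *\<^sub>R real_part x + (- Im c) *\<^sub>R imag_part x"
proof -
  have 1: "complex_of_real (Re c) / 2 + (- complex_of_real (Im c)) * (- \<i>/2) = c / 2"
    "complex_of_real (Re c) / 2 - (- complex_of_real (Im c)) * (- \<i>/2) = cnj c / 2"
    by (simp_all add: complex_eq_iff)
  have "real_part (c *\<^sub>C x) = (c / 2) *\<^sub>C x + (cnj c / 2) *\<^sub>C star x"
    by (simp add: real_part_def star_scaleC scaleC_add_right scaleC_scaleC)
  also have "\<dots> = Re c *\<^sub>R real_part x + (- Im c) *\<^sub>R imag_part x"
    unfolding 1[symmetric]
    by (simp add: real_part_def imag_part_def scaleR_scaleC scaleC_add_right scaleC_scaleC
        scaleC_add_left scaleC.scale_left_diff_distrib scaleC.scale_right_diff_distrib)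
  finally show ?thesis .
qed

lemma imag_part_eq_real_part: "imag_part x = real_part ((- \<i>) *\<^sub>C x)"
  by (simp add: imag_part_def real_part_def star_scaleC star_minus scaleC_scaleC
      scaleC.scale_right_diff_distrib scaleC_add_right)

lemma imag_part_scaleC:
  "imag_part (c *\<^sub>C x) = Re c *\<^sub>R imag_part x + Im c *\<^sub>R real_part x"
proof -
  have "imag_part (c *\<^sub>C x) = real_part ((- \<i> * c) *\<^sub>C x)"
    by (simp add: imag_part_eq_real_part scaleC_scaleC)
  also have "\<dots> = Re c *\<^sub>R imag_part x + Im c *\<^sub>R real_part x"
    by (subst real_part_scaleC) simp
  finally show ?thesis .
qed

lemma real_part_sa: "x \<in> sa UNIV \<Longrightarrow> real_part x = x"
  by (simp add: real_part_def sa_def scaleC_add_right flip: scaleC_add_left)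

lemma imag_part_sa: "x \<in> sa UNIV \<Longrightarrow> imag_part x = 0"
  by (simp add: imag_part_def sa_def)

lemma real_part_add: "real_part (x + y) = real_part x + real_part y"
  by (simp add: real_part_def star_add scaleC_add_right algebra_simps)

lemma imag_part_add: "imag_part (x + y) = imag_part x + imag_part y"
  unfolding imag_part_eq_real_part scaleC_add_right by (rule real_part_add)

lemma sa_scaleR: "x \<in> sa UNIV \<Longrightarrow> t *\<^sub>R x \<in> sa (UNIV :: 'a::star_vector set)"
  by (simp add: sa_def scaleR_scaleC star_scaleC)

text \<open>Every \<open>x\<close> is its real part plus \<open>\<i>\<close> times its imaginary part, both depending
  continuously and real-linearly on \<open>x\<close>, so \<open>g\<close> extends by \<open>g (real_part x) + \<i> g (imag_part x)\<close>.\<close>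

lemma complexify_real_functional:
  fixes g :: "'v::star_locally_convex \<Rightarrow> real"
  assumes add: "\<And>x y. x \<in> sa UNIV \<Longrightarrow> y \<in> sa UNIV \<Longrightarrow> g (x + y) = g x + g y"
    and scale: "\<And>x t. x \<in> sa UNIV \<Longrightarrow> g (t *\<^sub>R x) = t * g x"
    and cont: "continuous_on (sa UNIV) g"
  obtains f :: "'v \<Rightarrow> complex" where "Vector_Spaces.linear scaleC scaleC f"
    "continuous_on UNIV f" "\<And>x. x \<in> sa UNIV \<Longrightarrow> f x = complex_of_real (g x)"
proof
  define f where "f x = Complex (g (real_part x)) (g (imag_part x))" for x
  note sa = real_part_in_sa imag_part_in_sa sa_scaleR
  show "Vector_Spaces.linear scaleC scaleC f"
    unfolding clinear_iff
  proof (intro conjI allI)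
    show "f (x + y) = f x + f y" for x y
      unfolding f_def real_part_add imag_part_add by (simp add: add sa complex_eq_iff)
    show "f (c *\<^sub>C x) = c *\<^sub>C f x" for c x
      unfolding f_def real_part_scaleC imag_part_scaleC
      by (simp only: add scale sa) (simp add: scaleC_complex_def complex_eq_iff)
  qed
  have "continuous_on UNIV (real_part :: 'v \<Rightarrow> 'v)" "continuous_on UNIV (imag_part :: 'v \<Rightarrow> 'v)"
    unfolding real_part_def imag_part_def
    by (intro continuous_on_scaleC continuous_intros continuous_on_star)+
  then have "continuous_on UNIV (\<lambda>x. g (real_part x))" "continuous_on UNIV (\<lambda>x. g (imag_part x))"
    using continuous_on_compose2[OF cont] sa(1,2) by blast+
  then show "continuous_on UNIV f"
    unfolding f_def Complex_eq by (intro continuous_intros)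
  show "f x = complex_of_real (g x)" if "x \<in> sa UNIV" for x
    using that scale[of x 0] by (simp add: f_def real_part_sa imag_part_sa complex_eq_iff)
qed

section \<open>Lead points\<close>

text \<open>The scalars \<open>\<alpha> \<in> [0, 1]\<close> with \<open>x \<in> \<alpha> S\<close> form a compact set, the projection of a closed
  subset of \<open>[0, 1] \<times> S\<close>. If \<open>\<alpha>\<close> is the least of them and \<open>x = \<alpha> y\<close>, then \<open>y\<close> cannot be shrunk
  out of a further point of \<open>S\<close>, since that would give a smaller scalar. Taking the least factor
  rather than the largest dilation of \<open>x\<close> avoids any appeal to boundedness in \<open>V\<close>.\<close>

lemma compact_multiple_of_lead:
  fixes S :: "'v::star_locally_convex set"
  assumes "compact S" "x \<in> S" "x \<noteq> 0"
  obtains \<alpha> y where "0 \<le> \<alpha>" "\<alpha> \<le> 1" "y \<in> lead S" "x = \<alpha> *\<^sub>R y"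
proof -
  define P where "P = ({0..1} \<times> S) \<inter> {p. complex_of_real (fst p) *\<^sub>C snd p = x}"
  have "closed {p :: real \<times> 'v. complex_of_real (fst p) *\<^sub>C snd p = x}"
    by (intro closed_Collect_eq continuous_on_scaleC continuous_intros)
  then have "compact P"
    unfolding P_def using assms(1) by (intro compact_Int_closed compact_Times) auto
  then have "compact (fst ` P)"
    by (intro compact_continuous_image continuous_intros)
  moreover have "(1, x) \<in> P"
    using assms by (simp add: P_def scaleC_one)
  ultimately obtain \<alpha> where "\<alpha> \<in> fst ` P" and min: "\<And>\<beta>. \<beta> \<in> fst ` P \<Longrightarrow> \<alpha> \<le> \<beta>"
    using compact_attains_inf[of "fst ` P"] by blast
  then obtain y where y: "0 \<le> \<alpha>" "\<alpha> \<le> 1" "y \<in> S" "x = \<alpha> *\<^sub>R y"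
    by (auto simp: P_def scaleR_scaleC)
  have "\<beta> = 1" if \<beta>: "z \<in> S" "\<beta> \<in> {0..1}" "y = \<beta> *\<^sub>R z" for z \<beta>
  proof -
    have "(\<alpha> * \<beta>, z) \<in> P"
      using y \<beta> by (auto simp: P_def mult_le_one simp flip: scaleR_scaleC)
    then have "\<alpha> \<le> \<alpha> * \<beta>"
      by (intro min) force
    moreover have "\<alpha> > 0"
      using y assms(3) by (cases "\<alpha> = 0") auto
    ultimately show ?thesis
      using \<beta>(2) by (auto intro: antisym)
  qed
  then have "y \<in> lead S"
    using y(3) unfolding lead_def by blast
  with y that show thesis by blast
qed

section \<open>The function space and its pairing with matrices\<close>

lemma scaleR_matrix_entry:
  "(t *\<^sub>R (a :: nat \<Rightarrow> nat \<Rightarrow> 'a::star_vector)) i j = complex_of_real t *\<^sub>C a i j"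
  unfolding scaleR_fun_def by (rule scaleR_scaleC)

lemma scaleC_function_value: "(c *\<^sub>C (f :: 'a \<Rightarrow> complex)) x = c * f x"
  by (simp add: scaleC_fun_def scaleC_complex_def)

lemma sum_function_value: "(\<Sum>i\<in>I. f i) x = (\<Sum>i\<in>I. f i x :: complex)"
  by (induction I rule: infinite_finite_induct) simp_all

(* Degree one occurs throughout as K 1, which the simplifier would turn into K (Suc 0). *)
declare One_nat_def [simp del]

definition pairing :: "(nat \<Rightarrow> (nat \<Rightarrow> nat \<Rightarrow> 'v::star_locally_convex) set) \<Rightarrow> nat \<Rightarrow>
    (nat \<Rightarrow> nat \<Rightarrow> 'v \<Rightarrow> complex) \<Rightarrow> (nat \<Rightarrow> nat \<Rightarrow> 'v) \<Rightarrow> complex" where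
  "pairing K n a v = (\<Sum>i<n. \<Sum>j<n. ext K (a i j) (v i j))"

lemma A0_cone_pairing:
  "A0_cone K n = {a \<in> mats_sa (A0 K) n. \<forall>v\<in>K n. pairing K n a v \<in> \<real>\<^sub>\<ge>\<^sub>0}"
  unfolding A0_cone_def pairing_def ..

lemma mstar_compress:
  assumes "mstar u = u"
  shows "mstar (compress n \<gamma> u) = compress n \<gamma> u"
proof (intro ext)
  fix i j
  have u: "star (u k l) = u l k" for k l
    using assms by (metis mstar_def)
  have "mstar (compress n \<gamma> u) i j = (\<Sum>k<n. \<Sum>l<n. (cnj (\<gamma> l i) * \<gamma> k j) *\<^sub>C u l k)"
    by (simp add: mstar_def compress_def star_sum star_scaleC u mult.commute)
  also have "\<dots> = compress n \<gamma> u i j"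
    unfolding compress_def by (rule sum.swap)
  finally show "mstar (compress n \<gamma> u) i j = compress n \<gamma> u i j" .
qed

lemma compress_in_mats:
  assumes "scaleC.subspace W" "u \<in> mats W m m" "\<gamma> \<in> mats UNIV m n"
  shows "compress m \<gamma> u \<in> mats W n n"
proof -
  have "compress m \<gamma> u i j \<in> W" for i j
    unfolding compress_def using assms(2)
    by (intro scaleC.subspace_sum scaleC.subspace_scale assms(1)) (simp add: mats_def)
  moreover have "compress m \<gamma> u i j = 0" if "i \<ge> n \<or> j \<ge> n" for i j
    using that assms(3) by (auto simp: compress_def mats_def)
  ultimately show ?thesis
    by (simp add: mats_def)
qed

text \<open>Spanning makes linear extensions unique, convexity makes restrictions of linear functionals
  affine, and self-adjointness makes \<open>A\<^sub>0(K\<^sub>1, V)\<close> closed under the involution.\<close>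

locale spanning_base =
  fixes K :: "nat \<Rightarrow> (nat \<Rightarrow> nat \<Rightarrow> 'v::star_locally_convex) set"
  assumes base_sa: "entries1 (K 1) \<subseteq> sa UNIV"
    and base_zero: "0 \<in> entries1 (K 1)"
    and base_convex: "convex (entries1 (K 1))"
    and base_span: "scaleC.span (entries1 (K 1)) = UNIV"
begin

abbreviation "K1 \<equiv> entries1 (K 1)"

text \<open>Continuity, affinity and vanishing at 0 are inherited from the linear extension.\<close>

lemma A0_iff: "a \<in> A0 K \<longleftrightarrow> (\<exists>f. linear_extension K1 a f) \<and> (\<forall>x. x \<notin> K1 \<longrightarrow> a x = 0)"
proof -
  have "continuous_on K1 a \<and> affine_map_on K1 a \<and> a 0 = 0"
    if ext: "linear_extension K1 a f" for f
  proof -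
    have eq: "a x = f x" if "x \<in> K1" for x
      using ext that by (simp add: linear_extension_def)
    have lin: "f (x + y) = f x + f y" "f (c *\<^sub>C x) = c * f x" for x y c
      using ext by (simp_all add: linear_extension_def clinear_iff scaleC_complex_def)
    have "continuous_on K1 f"
      using ext continuous_on_subset unfolding linear_extension_def by blast
    then have "continuous_on K1 a"
      by (simp add: eq cong: continuous_on_cong)
    moreover have "affine_map_on K1 a"
      unfolding affine_map_on_def
    proof (intro ballI)
      fix x y and t :: real
      assume *: "x \<in> K1" "y \<in> K1" "t \<in> {0..1}"
      then have "(1 - t) *\<^sub>R x + t *\<^sub>R y \<in> K1"
        using base_convex by (simp add: convex_alt)
      then have "a ((1 - t) *\<^sub>R x + t *\<^sub>R y) = f ((1 - t) *\<^sub>R x + t *\<^sub>R y)"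
        by (rule eq)
      also have "\<dots> = (1 - t) *\<^sub>R a x + t *\<^sub>R a y"
        using * unfolding scaleR_scaleC[where 'a = 'v] lin by (simp add: eq scaleR_conv_of_real)
      finally show "a ((1 - t) *\<^sub>R x + t *\<^sub>R y) = (1 - t) *\<^sub>R a x + t *\<^sub>R a y" .
    qed
    moreover have "a 0 = 0"
      using eq[OF base_zero] lin(2)[of 0 0] by simp
    ultimately show ?thesis by blast
  qed
  then show ?thesis
    by (auto simp: A0_def Let_def)
qed

lemma ext_eqI:
  assumes "linear_extension K1 a f"
  shows "ext K a = f"
  unfolding ext_def
proof (rule the_equality)
  show "linear_extension K1 a f" by (rule assms)
  show "g = f" if "linear_extension K1 a g" for g
    using that assms clinear_eq_if_eq_on_spanning_set[OF _ _ base_span, of g f]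
    by (simp add: linear_extension_def)
qed

lemma linear_extension_ext: "a \<in> A0 K \<Longrightarrow> linear_extension K1 a (ext K a)"
  by (auto simp: A0_iff ext_eqI)

lemma ext_base: "a \<in> A0 K \<Longrightarrow> x \<in> K1 \<Longrightarrow> ext K a x = a x"
  using linear_extension_ext by (simp add: linear_extension_def)

lemma ext_add_arg: "a \<in> A0 K \<Longrightarrow> ext K a (x + y) = ext K a x + ext K a y"
  and ext_scaleC_arg: "a \<in> A0 K \<Longrightarrow> ext K a (c *\<^sub>C x) = c * ext K a x"
  using linear_extension_ext by (simp_all add: linear_extension_def clinear_iff scaleC_complex_def)

lemma ext_sum_arg:
  assumes "a \<in> A0 K"
  shows "ext K a (\<Sum>i\<in>I. f i) = (\<Sum>i\<in>I. ext K a (f i))"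
  using ext_scaleC_arg[OF assms, of 0 0]
  by (induction I rule: infinite_finite_induct) (simp_all add: ext_add_arg[OF assms])

lemma linear_extension_add:
  "linear_extension K1 a f \<Longrightarrow> linear_extension K1 b g \<Longrightarrow> linear_extension K1 (a + b) (f + g)"
  by (auto simp: linear_extension_def clinear_iff scaleC_add_right plus_fun_def intro: continuous_on_add)

lemma linear_extension_scaleC:
  "linear_extension K1 a f \<Longrightarrow> linear_extension K1 (c *\<^sub>C a) (c *\<^sub>C f)"
  by (auto simp: linear_extension_def clinear_iff scaleC_fun_def scaleC_complex_def algebra_simps
      intro: continuous_on_mult_left)

text \<open>The adjoint functional \<open>x \<mapsto> cnj (f (star x))\<close> agrees with \<open>cnj (f x)\<close> on \<open>K\<^sub>1\<close> because \<open>K\<^sub>1\<close>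
  consists of self-adjoint elements.\<close>

lemma linear_extension_star:
  assumes "linear_extension K1 a f"
  shows "linear_extension K1 (star a) (\<lambda>x. cnj (f (star x)))"
  using assms base_sa
  by (auto simp: linear_extension_def clinear_iff star_fun_def star_complex_def scaleC_complex_def
      star_add star_scaleC sa_def
      intro!: continuous_on_cnj continuous_on_compose2[OF _ continuous_on_star])

lemma linear_extension_zero: "linear_extension K1 0 (\<lambda>_. 0)"
  by (simp add: linear_extension_def clinear_iff)

lemma A0_star_subspace: "star_subspace (A0 K)"
  unfolding star_subspace_def
proof
  show "scaleC.subspace (A0 K)"
    unfolding scaleC.subspace_def
  proof (intro conjI ballI allI)
    show "0 \<in> A0 K"
      using linear_extension_zero by (auto simp: A0_iff)
    show "a + b \<in> A0 K" if "a \<in> A0 K" "b \<in> A0 K" for a b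
      using linear_extension_add[OF that[THEN linear_extension_ext]] that by (auto simp: A0_iff)
    show "c *\<^sub>C a \<in> A0 K" if "a \<in> A0 K" for a c
      using linear_extension_scaleC[OF linear_extension_ext[OF that], of c] that
      by (auto simp: A0_iff scaleC_function_value)
  qed
  show "star ` A0 K \<subseteq> A0 K"
  proof
    fix b assume "b \<in> star ` A0 K"
    then obtain a where a: "a \<in> A0 K" "b = star a" by blast
    show "b \<in> A0 K"
      using linear_extension_star[OF linear_extension_ext[OF a(1)]] a
      by (auto simp: A0_iff star_fun_def)
  qed
qed

lemmas A0_subspace = A0_star_subspace[unfolded star_subspace_def, THEN conjunct1]
lemmas A0_zero = scaleC.subspace_0[OF A0_subspace]
  and A0_add = scaleC.subspace_add[OF A0_subspace]
  and A0_scaleC = scaleC.subspace_scale[OF A0_subspace]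
  and A0_sum = scaleC.subspace_sum[OF A0_subspace]

lemma ext_add: "a \<in> A0 K \<Longrightarrow> b \<in> A0 K \<Longrightarrow> ext K (a + b) = ext K a + ext K b"
  by (intro ext_eqI linear_extension_add linear_extension_ext)

lemma ext_scaleC: "a \<in> A0 K \<Longrightarrow> ext K (c *\<^sub>C a) = c *\<^sub>C ext K a"
  by (intro ext_eqI linear_extension_scaleC linear_extension_ext)

lemma ext_zero: "ext K 0 = 0"
  by (simp add: ext_eqI[OF linear_extension_zero] fun_eq_iff)

lemma ext_sum: "(\<And>i. i \<in> I \<Longrightarrow> f i \<in> A0 K) \<Longrightarrow> ext K (sum f I) = (\<Sum>i\<in>I. ext K (f i))"
proof (induction I rule: infinite_finite_induct)
  case (insert i I)
  have "ext K (sum f (insert i I)) = ext K (f i + sum f I)"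
    by (simp only: sum.insert insert.hyps not_False_eq_True)
  also have "\<dots> = ext K (f i) + ext K (sum f I)"
    using insert.prems by (intro ext_add A0_sum) auto
  finally show ?case
    using insert by (simp only: sum.insert insertI1 insertI2 not_False_eq_True)
qed (simp_all only: sum.infinite sum.empty ext_zero not_False_eq_True)

lemma pairing_add:
  "a \<in> mats (A0 K) n n \<Longrightarrow> b \<in> mats (A0 K) n n \<Longrightarrow>
    pairing K n (a + b) v = pairing K n a v + pairing K n b v"
  by (simp add: pairing_def mats_def ext_add sum.distrib)

lemma pairing_scaleR:
  "a \<in> mats (A0 K) n n \<Longrightarrow> pairing K n (t *\<^sub>R a) v = of_real t * pairing K n a v"
  by (simp add: pairing_def mats_def scaleR_matrix_entry ext_scaleC scaleC_function_value
      sum_distrib_left)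

lemma pairing_scaleR_arg:
  "a \<in> mats (A0 K) n n \<Longrightarrow> pairing K n a (t *\<^sub>R v) = of_real t * pairing K n a v"
  by (simp add: pairing_def mats_def scaleR_matrix_entry ext_scaleC_arg sum_distrib_left)

text \<open>Both sides are the sum of \<open>cnj (\<gamma> k i) \<gamma> l j ext (a k l) (v i j)\<close> over all four indices. The
  transpose of \<open>\<gamma>\<close>, not its adjoint, appears because the pairing is bilinear.\<close>

lemma pairing_compress:
  assumes a: "a \<in> mats (A0 K) m m"
  shows "pairing K n (compress m \<gamma> a) v = pairing K m a (compress n (\<lambda>j k. \<gamma> k j) v)"
proof -
  let ?t = "\<lambda>i j k l. cnj (\<gamma> k i) * \<gamma> l j * ext K (a k l) (v i j)"
  have a': "a k l \<in> A0 K" if "k < m" "l < m" for k l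
    using a that by (simp add: mats_def)
  have "ext K (compress m \<gamma> a i j) x
      = (\<Sum>k<m. \<Sum>l<m. cnj (\<gamma> k i) * \<gamma> l j * ext K (a k l) x)" for i j x
  proof -
    have row: "(\<Sum>l<m. (cnj (\<gamma> k i) * \<gamma> l j) *\<^sub>C a k l) \<in> A0 K" if "k < m" for k
      using that by (intro A0_sum A0_scaleC a') simp_all
    have "ext K (compress m \<gamma> a i j)
        = (\<Sum>k<m. ext K (\<Sum>l<m. (cnj (\<gamma> k i) * \<gamma> l j) *\<^sub>C a k l))"
      unfolding compress_def by (rule ext_sum) (simp add: row)
    also have "\<dots> = (\<Sum>k<m. \<Sum>l<m. ext K ((cnj (\<gamma> k i) * \<gamma> l j) *\<^sub>C a k l))"
      by (intro sum.cong refl ext_sum A0_scaleC a') simp_all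
    also have "\<dots> = (\<Sum>k<m. \<Sum>l<m. (cnj (\<gamma> k i) * \<gamma> l j) *\<^sub>C ext K (a k l))"
      by (intro sum.cong refl ext_scaleC a') simp_all
    finally show ?thesis
      by (simp only: sum_function_value scaleC_function_value)
  qed
  then have "pairing K n (compress m \<gamma> a) v = (\<Sum>i<n. \<Sum>j<n. \<Sum>k<m. \<Sum>l<m. ?t i j k l)"
    by (simp add: pairing_def)
  also have "\<dots> = (\<Sum>i<n. \<Sum>k<m. \<Sum>j<n. \<Sum>l<m. ?t i j k l)"
    by (rule sum.cong[OF refl], rule sum.swap)
  also have "\<dots> = (\<Sum>k<m. \<Sum>i<n. \<Sum>j<n. \<Sum>l<m. ?t i j k l)"
    by (rule sum.swap)
  also have "\<dots> = (\<Sum>k<m. \<Sum>i<n. \<Sum>l<m. \<Sum>j<n. ?t i j k l)"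
    by (rule sum.cong[OF refl], rule sum.cong[OF refl], rule sum.swap)
  also have "\<dots> = (\<Sum>k<m. \<Sum>l<m. \<Sum>i<n. \<Sum>j<n. ?t i j k l)"
    by (rule sum.cong[OF refl], rule sum.swap)
  also have "\<dots> = pairing K m a (compress n (\<lambda>j k. \<gamma> k j) v)"
    unfolding pairing_def compress_def
    by (intro sum.cong refl) (simp add: ext_sum_arg ext_scaleC_arg a')
  finally show ?thesis .
qed

lemma mats_sa_A0_closed:
  shows "0 \<in> mats_sa (A0 K) n"
    and "a \<in> mats_sa (A0 K) n \<Longrightarrow> b \<in> mats_sa (A0 K) n \<Longrightarrow> a + b \<in> mats_sa (A0 K) n"
    and "a \<in> mats_sa (A0 K) n \<Longrightarrow> t *\<^sub>R a \<in> mats_sa (A0 K) n"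
    and "a \<in> mats_sa (A0 K) m \<Longrightarrow> \<gamma> \<in> mats UNIV m n \<Longrightarrow> compress m \<gamma> a \<in> mats_sa (A0 K) n"
proof -
  show "0 \<in> mats_sa (A0 K) n"
    by (simp add: mats_sa_def mats_def mstar_def A0_zero fun_eq_iff)
  show "a + b \<in> mats_sa (A0 K) n" if "a \<in> mats_sa (A0 K) n" "b \<in> mats_sa (A0 K) n"
    using that by (simp add: mats_sa_def mats_def mstar_def A0_add fun_eq_iff star_add)
  show "t *\<^sub>R a \<in> mats_sa (A0 K) n" if "a \<in> mats_sa (A0 K) n"
  proof -
    have "star (a j i) = a i j" for i j
      using that by (metis (mono_tags, lifting) mats_sa_def mem_Collect_eq mstar_def)
    then have "mstar (t *\<^sub>R a) = t *\<^sub>R a"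
      by (intro ext) (simp add: mstar_def scaleR_matrix_entry star_scaleC)
    then show ?thesis
      using that by (simp add: mats_sa_def mats_def A0_scaleC scaleR_matrix_entry)
  qed
  show "compress m \<gamma> a \<in> mats_sa (A0 K) n"
    if "a \<in> mats_sa (A0 K) m" "\<gamma> \<in> mats UNIV m n"
    using that by (simp add: mats_sa_def mstar_compress compress_in_mats[OF A0_subspace])
qed

lemma mats_saD: "a \<in> mats_sa (A0 K) n \<Longrightarrow> a \<in> mats (A0 K) n n"
  by (simp add: mats_sa_def)

lemma A0_cone_cone_in: "cone_in (mats_sa (A0 K) n) (A0_cone K n)"
proof -
  have "pairing K n 0 v = 0" for v
    by (simp add: pairing_def ext_eqI[OF linear_extension_zero])
  then have "0 \<in> A0_cone K n"
    by (simp add: A0_cone_pairing mats_sa_A0_closed(1))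
  then have "A0_cone K n \<noteq> {}"
    by blast
  then show ?thesis
    unfolding cone_in_def
    by (auto simp: A0_cone_pairing mats_sa_A0_closed pairing_add pairing_scaleR mats_saD
        intro!: nonneg_Reals_add_I nonneg_Reals_mult_I)
qed

text \<open>Positivity of \<open>a\<close> on \<open>K m\<close> extends to all positive multiples of \<open>K m\<close>, so it is enough that
  the adjoint compression absorbs \<open>K n\<close> into these.\<close>

lemma A0_cone_compress:
  assumes a: "a \<in> A0_cone K m" and \<gamma>: "\<gamma> \<in> mats UNIV m n"
    and absorb: "\<And>v. v \<in> K n \<Longrightarrow> \<exists>r>0. r *\<^sub>R compress n (\<lambda>j k. \<gamma> k j) v \<in> K m"
  shows "compress m \<gamma> a \<in> A0_cone K n"
proof -
  have a': "a \<in> mats_sa (A0 K) m" "\<And>v. v \<in> K m \<Longrightarrow> pairing K m a v \<in> \<real>\<^sub>\<ge>\<^sub>0"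
    using a by (simp_all add: A0_cone_pairing)
  have "pairing K n (compress m \<gamma> a) v \<in> \<real>\<^sub>\<ge>\<^sub>0" if v: "v \<in> K n" for v
  proof -
    let ?w = "compress n (\<lambda>j k. \<gamma> k j) v"
    obtain r where r: "r > 0" "r *\<^sub>R ?w \<in> K m"
      using absorb[OF v] by blast
    then have "of_real r * pairing K m a ?w \<in> \<real>\<^sub>\<ge>\<^sub>0"
      using a'(2)[OF r(2)] by (simp add: pairing_scaleR_arg mats_saD[OF a'(1)])
    then show ?thesis
      using r(1)
      by (simp add: pairing_compress mats_saD[OF a'(1)] complex_nonneg_Reals_iff zero_le_mult_iff)
  qed
  then show ?thesis
    using a'(1) \<gamma> by (simp add: A0_cone_pairing mats_sa_A0_closed(4))
qed

text \<open>On each \<open>v\<close> the assumption reads \<open>a(v) + t b(v) \<ge> 0\<close> for \<open>t > 0\<close>; the limit \<open>t \<rightarrow> 0\<close> gives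
  the claim.\<close>

lemma A0_cone_archimedean: "archimedean_cone (mats_sa (A0 K) n) (A0_cone K n)"
  unfolding archimedean_cone_def
proof (intro ballI impI)
  fix b a
  assume b: "b \<in> A0_cone K n" and a: "a \<in> mats_sa (A0 K) n"
    and le: "\<forall>t>0. a - (- t *\<^sub>R b) \<in> A0_cone K n"
  have "pairing K n a v \<in> \<real>\<^sub>\<ge>\<^sub>0" if v: "v \<in> K n" for v
  proof -
    have b': "b \<in> mats_sa (A0 K) n" "pairing K n b v \<in> \<real>\<^sub>\<ge>\<^sub>0"
      using b v by (simp_all add: A0_cone_pairing)
    have t: "pairing K n a v + of_real t * pairing K n b v \<in> \<real>\<^sub>\<ge>\<^sub>0" if "t > 0" for t
    proof -
      have "a + t *\<^sub>R b \<in> A0_cone K n"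
        using le that by simp
      then have "pairing K n (a + t *\<^sub>R b) v \<in> \<real>\<^sub>\<ge>\<^sub>0"
        using v by (simp add: A0_cone_pairing)
      then show ?thesis
        by (simp add: pairing_add pairing_scaleR mats_saD a b' mats_sa_A0_closed)
    qed
    have "((\<lambda>t. pairing K n a v + of_real t * pairing K n b v) \<longlongrightarrow>
        pairing K n a v + of_real 0 * pairing K n b v) (at_right (0::real))"
      by (intro tendsto_intros)
    then have "pairing K n a v + of_real 0 * pairing K n b v \<in> \<real>\<^sub>\<ge>\<^sub>0"
      by (rule Lim_in_closed_set[rotated 3])
        (auto simp: t eventually_at_right_less intro!: eventually_at_rightI[of 0 1])
    then show ?thesis by simp
  qed
  with a show "a \<in> A0_cone K n"
    by (simp add: A0_cone_pairing)
qed

lemma pairing_1: "pairing K 1 a v = ext K (a 0 0) (v 0 0)"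
  by (simp add: pairing_def One_nat_def)

text \<open>Self-adjointness is automatic in degree one, since the functions are real on \<open>K\<^sub>1\<close> and zero
  elsewhere.\<close>

lemma entries1_A0_cone:
  "entries1 (A0_cone K 1) = {a \<in> A0 K. \<forall>x\<in>K1. a x \<in> \<real>\<^sub>\<ge>\<^sub>0}" (is "?P = ?Q")
proof
  show "?P \<subseteq> ?Q"
  proof
    fix a assume "a \<in> ?P"
    then obtain M where M: "M \<in> mats_sa (A0 K) 1" "a = M 0 0" "\<forall>v\<in>K 1. pairing K 1 M v \<in> \<real>\<^sub>\<ge>\<^sub>0"
      by (auto simp: entries1_def A0_cone_pairing)
    then have "a \<in> A0 K"
      by (simp add: mats_sa_def mats_def)
    moreover have "ext K a x \<in> \<real>\<^sub>\<ge>\<^sub>0" if "x \<in> K1" for x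
      using M that by (auto simp: entries1_def pairing_1)
    ultimately show "a \<in> ?Q"
      by (simp add: ext_base)
  qed
  show "?Q \<subseteq> ?P"
  proof
    fix a assume a: "a \<in> ?Q"
    define M where "M = (\<lambda>(i::nat) (j::nat). if i = 0 \<and> j = 0 then a else 0)"
    have "star a = a"
    proof
      show "star a x = a x" for x
        using a by (cases "x \<in> K1")
          (auto simp: star_fun_def star_complex_def A0_iff elim!: nonneg_Reals_cases)
    qed
    then have "M \<in> mats_sa (A0 K) 1"
      using a by (auto simp: mats_sa_def mats_def mstar_def M_def fun_eq_iff star_fun_def)
    moreover have "pairing K 1 M v \<in> \<real>\<^sub>\<ge>\<^sub>0" if "v \<in> K 1" for v
      using a that by (simp add: pairing_1 M_def ext_base entries1_def)
    ultimately have "M \<in> A0_cone K 1"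
      by (simp add: A0_cone_pairing)
    then show "a \<in> ?P"
      unfolding entries1_def by (rule rev_image_eqI) (simp add: M_def)
  qed
qed

lemma A0_cone_proper: "proper_cone (entries1 (A0_cone K 1))"
proof -
  have "a = 0" if "a \<in> entries1 (A0_cone K 1)" "- a \<in> entries1 (A0_cone K 1)" for a
  proof
    fix x
    show "a x = 0 x"
    proof (cases "x \<in> K1")
      case True
      with that have "a x \<in> \<real>\<^sub>\<ge>\<^sub>0" "- a x \<in> \<real>\<^sub>\<ge>\<^sub>0"
        by (auto simp: entries1_A0_cone)
      then show ?thesis
        by (simp add: complex_nonneg_Reals_iff complex_eq_iff)
    next
      case False
      with that show ?thesis
        by (simp add: entries1_A0_cone A0_iff)
    qed
  qed
  moreover have "0 \<in> entries1 (A0_cone K 1)"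
    by (simp add: entries1_A0_cone A0_zero)
  ultimately show ?thesis
    unfolding proper_cone_def by (auto intro!: rev_image_eqI[of 0]) 
qed

text \<open>A point \<open>x \<in> K\<^sub>1\<close> is \<open>\<alpha> y\<close> with \<open>f x = \<alpha> \<ge> 0\<close> and \<open>y \<in> K\<^sub>1\<close>. By homogeneity
  \<open>w x = \<alpha> w y\<close>, so a bound \<open>t\<close> for \<open>w\<close> on the compact set \<open>K\<^sub>1\<close> becomes \<open>\<bar>w x\<bar> \<le> t f x\<close>.\<close>

lemma order_unit_if_one_on_lead:
  assumes compact: "compact K1"
    and lin: "Vector_Spaces.linear scaleC scaleC f" and cont: "continuous_on UNIV f"
    and one: "\<And>x. x \<in> lead K1 \<Longrightarrow> f x = 1"
  shows "order_unit (A0 K) (entries1 (A0_cone K 1)) (\<lambda>x. if x \<in> K1 then f x else 0)"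
    (is "order_unit _ _ ?e")
proof -
  have "linear_extension K1 ?e f"
    using lin cont by (simp add: linear_extension_def)
  then have e: "?e \<in> A0 K"
    unfolding A0_iff by auto
  have homogeneous: "g (\<alpha> *\<^sub>R y) = of_real \<alpha> * g y"
    if "Vector_Spaces.linear scaleC scaleC g" for g :: "'v \<Rightarrow> complex" and \<alpha> y
    using that by (simp add: clinear_iff scaleR_scaleC scaleC_complex_def)
  (* The origin is never a lead point; it is represented with factor 0. *)
  have lead: "\<exists>\<alpha> y. \<alpha> \<ge> 0 \<and> y \<in> K1 \<and> f x = of_real \<alpha> \<and> x = \<alpha> *\<^sub>R y"
    if x: "x \<in> K1" for x
  proof (cases "x = 0")
    case True
    then show ?thesis
      using base_zero homogeneous[OF lin, of 0 0] by (intro exI[of _ 0]) auto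
  next
    case False
    obtain \<alpha> y where *: "0 \<le> \<alpha>" "y \<in> lead K1" "x = \<alpha> *\<^sub>R y"
      using compact_multiple_of_lead[OF compact x False] by blast
    then have "f x = of_real \<alpha>"
      using homogeneous[OF lin] one by simp
    with * show ?thesis
      by (auto simp: lead_def)
  qed
  have "?e \<in> entries1 (A0_cone K 1)"
    unfolding entries1_A0_cone using e lead by fastforce
  moreover have "\<exists>t>0. w - (- t *\<^sub>R ?e) \<in> entries1 (A0_cone K 1) \<and>
      t *\<^sub>R ?e - w \<in> entries1 (A0_cone K 1)" if w: "w \<in> sa (A0 K)" for w
  proof -
    have w': "w \<in> A0 K" "\<And>x. cnj (w x) = w x"
      using w by (auto simp: sa_def star_fun_def star_complex_def fun_eq_iff)
    have "compact (w ` K1)"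
      using w'(1) compact by (intro compact_continuous_image) (auto simp: A0_def Let_def)
    then obtain t where t: "t > 0" "\<And>x. x \<in> K1 \<Longrightarrow> norm (w x) \<le> t"
      using compact_imp_bounded bounded_pos by (metis imageI)
    have mem: "w + t *\<^sub>R ?e \<in> A0 K" "t *\<^sub>R ?e - w \<in> A0 K"
      using w'(1) e scaleC.subspace_diff[OF A0_subspace] by (simp_all add: A0_add A0_scaleC scaleR_scaleC)
    have "w x + of_real t * f x \<in> \<real>\<^sub>\<ge>\<^sub>0 \<and> of_real t * f x - w x \<in> \<real>\<^sub>\<ge>\<^sub>0" if x: "x \<in> K1" for x
    proof -
      obtain \<alpha> y where \<alpha>: "\<alpha> \<ge> 0" "y \<in> K1" "f x = of_real \<alpha>" "x = \<alpha> *\<^sub>R y"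
        using lead[OF x] by blast
      have "w x = ext K w (\<alpha> *\<^sub>R y)"
        using w'(1) x \<alpha>(4) by (simp add: ext_base)
      also have "\<dots> = of_real \<alpha> * w y"
        using w'(1) \<alpha>(2) by (simp add: scaleR_scaleC ext_scaleC_arg ext_base)
      finally have wx: "w x = of_real \<alpha> * w y" .
      have im: "Im (w y) = 0"
        using w'(2)[of y] by (simp add: complex_eq_iff)
      have "\<bar>Re (w y)\<bar> \<le> t"
        using t(2)[OF \<alpha>(2)] abs_Re_le_cmod order_trans by blast
      then have "0 \<le> \<alpha> * (t + Re (w y))" "0 \<le> \<alpha> * (t - Re (w y))"
        using \<alpha>(1) by (simp_all add: mult_nonneg_nonneg)
      then show ?thesis
        by (simp add: wx \<alpha>(3) im complex_nonneg_Reals_iff algebra_simps)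
    qed
    then have "w + t *\<^sub>R ?e \<in> entries1 (A0_cone K 1)" "t *\<^sub>R ?e - w \<in> entries1 (A0_cone K 1)"
      unfolding entries1_A0_cone using mem by (auto simp: scaleR_fun_def scaleR_conv_of_real)
    then show ?thesis
      using t(1) by (intro exI[of _ t]) simp
  qed
  ultimately show ?thesis
    unfolding order_unit_def by blast
qed

end

section \<open>Scaling a matrix to a row contraction\<close>

text \<open>By the Cauchy-Schwarz inequality \<open>\<delta> \<delta>\<^sup>*\<close> is at most the squared Hilbert-Schmidt norm \<open>B\<close> of
  \<open>\<delta>\<close>, so any \<open>s\<close> with \<open>s\<^sup>2 B \<le> 1\<close> will do. The choice \<open>s\<^sup>2 = 1 / (1 + B)\<close> is also meaningful for
  \<open>\<delta> = 0\<close>.\<close>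

lemma row_contraction_scaled:
  obtains s :: real where "s > 0" "row_contraction n 1 (\<lambda>_. m) (\<lambda>_ i l. of_real s * \<delta> i l)"
proof -
  define B where "B = (\<Sum>l<m. \<Sum>i<n. (cmod (\<delta> i l))\<^sup>2)"
  define s where "s = 1 / sqrt (1 + B)"
  have "B \<ge> 0"
    by (simp add: B_def sum_nonneg)
  then have s: "s > 0" "s\<^sup>2 * B \<le> 1"
    by (simp_all add: s_def power_divide)
  have "(\<Sum>i<n. \<Sum>j<n. cnj (x i) *
      ((if i = j then 1 else 0) - (\<Sum>t<1::nat. \<Sum>l<m. (of_real s * \<delta> i l) * cnj (of_real s * \<delta> j l))) * x j)
      \<in> \<real>\<^sub>\<ge>\<^sub>0" (is "?q \<in> _") for x
  proof -
    define X where "X = (\<Sum>i<n. (cmod (x i))\<^sup>2)"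
    define y where "y l = (\<Sum>i<n. cnj (x i) * \<delta> i l)" for l
    (* The quadratic form is the squared norm of x minus s^2 times the squared norm of the
       vector y, the row vector obtained from the adjoint of x and \<delta>. *)
    have "?q = (\<Sum>i<n. \<Sum>j<n. (if i = j then cnj (x i) * x j else 0)
        - of_real (s\<^sup>2) * (\<Sum>l<m. (cnj (x i) * \<delta> i l) * cnj (cnj (x j) * \<delta> j l)))"
      by (intro sum.cong refl)
        (auto simp: algebra_simps sum_distrib_left sum_distrib_right power2_eq_square)
    also have "\<dots> = (\<Sum>i<n. cnj (x i) * x i)
        - of_real (s\<^sup>2) * (\<Sum>i<n. \<Sum>j<n. \<Sum>l<m. (cnj (x i) * \<delta> i l) * cnj (cnj (x j) * \<delta> j l))"
      by (simp add: sum_subtractf sum_distrib_left)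
    also have "(\<Sum>i<n. \<Sum>j<n. \<Sum>l<m. (cnj (x i) * \<delta> i l) * cnj (cnj (x j) * \<delta> j l))
        = (\<Sum>i<n. \<Sum>l<m. \<Sum>j<n. (cnj (x i) * \<delta> i l) * cnj (cnj (x j) * \<delta> j l))"
      by (rule sum.cong[OF refl], rule sum.swap)
    also have "\<dots> = (\<Sum>l<m. \<Sum>i<n. \<Sum>j<n. (cnj (x i) * \<delta> i l) * cnj (cnj (x j) * \<delta> j l))"
      by (rule sum.swap)
    also have "\<dots> = (\<Sum>l<m. y l * cnj (y l))"
      by (simp add: y_def sum_product)
    also have "\<dots> = of_real (\<Sum>l<m. (cmod (y l))\<^sup>2)"
      by (simp add: complex_norm_square del: of_real_power)
    also have "(\<Sum>i<n. cnj (x i) * x i) = of_real X"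
      by (simp add: X_def complex_norm_square mult.commute del: of_real_power)
    finally have q: "?q = of_real (X - s\<^sup>2 * (\<Sum>l<m. (cmod (y l))\<^sup>2))"
      by simp
    have "(cmod (y l))\<^sup>2 \<le> X * (\<Sum>i<n. (cmod (\<delta> i l))\<^sup>2)" for l
    proof -
      have "cmod (y l) \<le> (\<Sum>i<n. cmod (x i) * cmod (\<delta> i l))"
        unfolding y_def by (rule order_trans[OF norm_sum]) (simp add: norm_mult)
      then have "(cmod (y l))\<^sup>2 \<le> (\<Sum>i<n. cmod (x i) * cmod (\<delta> i l))\<^sup>2"
        by (rule power_mono) simp
      also have "\<dots> \<le> X * (\<Sum>i<n. (cmod (\<delta> i l))\<^sup>2)"
        unfolding X_def by (rule Cauchy_Schwarz_ineq_sum)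
      finally show ?thesis .
    qed
    then have "(\<Sum>l<m. (cmod (y l))\<^sup>2) \<le> X * B"
      unfolding B_def sum_distrib_left by (rule sum_mono)
    then have "s\<^sup>2 * (\<Sum>l<m. (cmod (y l))\<^sup>2) \<le> s\<^sup>2 * (X * B)"
      by (rule mult_left_mono) simp
    also have "\<dots> \<le> X"
      using mult_left_mono[OF s(2), of X] by (simp add: X_def sum_nonneg algebra_simps)
    finally show ?thesis
      unfolding q nonneg_Reals_of_real_iff by linarith
  qed
  then have "row_contraction n 1 (\<lambda>_. m) (\<lambda>_ i l. of_real s * \<delta> i l)"
    unfolding row_contraction_def psd_def by blast
  with s(1) that show thesis by blast
qed

text \<open>The case of a single summand in the first axiom of \<open>L\<^sup>1\<close>-matrix convexity, applied to a
  multiple of \<open>\<delta>\<close> that is a row contraction.\<close>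

lemma L1_matrix_convex_absorbs_compress:
  assumes K: "L1_matrix_convex K" and nm: "n \<ge> 1" "m \<ge> 1"
    and u: "u \<in> K n" and \<delta>: "\<delta> \<in> mats UNIV n m"
  shows "\<exists>r>0. r *\<^sub>R compress n \<delta> u \<in> K m"
proof -
  obtain s :: real where s: "s > 0" "row_contraction n 1 (\<lambda>_. m) (\<lambda>_ i l. of_real s * \<delta> i l)"
    by (rule row_contraction_scaled)
  have "(\<lambda>i l. of_real s * \<delta> i l) \<in> mats UNIV n m"
    using \<delta> by (simp add: mats_def)
  then have "\<forall>i<1::nat. m \<ge> 1 \<and> (\<lambda>i l. of_real s * \<delta> i l) \<in> mats UNIV n m"
    using nm(2) by blast
  with s(2) have "direct_sum (\<lambda>_. m) (\<lambda>i. compress n (\<lambda>i l. of_real s * \<delta> i l) u) 1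
      \<in> K (\<Sum>i<1::nat. m)"
    using nm(1) u
    by (intro K[unfolded L1_matrix_convex_def, THEN conjunct2, THEN conjunct1, rule_format,
          where n = n and k = 1 and N = "\<lambda>_. m" and \<gamma> = "\<lambda>_ i l. of_real s * \<delta> i l" and u = u]
        conjI allI impI) simp_all
  moreover have "direct_sum (\<lambda>_. m) (\<lambda>i. compress n (\<lambda>i l. of_real s * \<delta> i l) u) 1
      = (s\<^sup>2) *\<^sub>R compress n \<delta> u"
    by (simp add: One_nat_def block_def compress_def fun_eq_iff scaleR_matrix_entry scaleC_scaleC
        scaleC.scale_sum_right power2_eq_square mult_ac)
  ultimately show ?thesis
    using s(1) by (intro exI[of _ "s\<^sup>2"]) simp
qed

section \<open>The order unit\<close>


text \<open>The functional is \<open>x \<mapsto> \<chi>(x)(1)\<close>, complexified. It is continuous because \<open>\<chi>\<close> is continuous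
  into the \<open>w\<^sup>*\<close>-topology, in which evaluation at a fixed function is continuous.\<close>

lemma regularly_embedded_unit_functional:
  fixes K :: "nat \<Rightarrow> (nat \<Rightarrow> nat \<Rightarrow> 'v::star_locally_convex) set"
  assumes "regularly_embedded K" and sa: "entries1 (K 1) \<subseteq> sa UNIV"
  obtains f :: "'v \<Rightarrow> complex" where "Vector_Spaces.linear scaleC scaleC f"
    "continuous_on UNIV f" "\<And>x. x \<in> lead (entries1 (K 1)) \<Longrightarrow> f x = 1"
proof -
  define L where "L = lead (entries1 (K 1))"
  obtain chi where L: "convex L"
    and chi: "\<And>u v s t a. \<lbrakk>u \<in> L; v \<in> L; s \<ge> 0; t \<ge> 0; a \<in> aff_sa L\<rbrakk> \<Longrightarrow>
        chi (s *\<^sub>R u - t *\<^sub>R v) a = s * a u - t * a v"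
    and add: "\<And>x y. x \<in> sa UNIV \<Longrightarrow> y \<in> sa UNIV \<Longrightarrow> chi (x + y) = chi x + chi y"
    and scale: "\<And>x t. x \<in> sa UNIV \<Longrightarrow> chi (t *\<^sub>R x) = t *\<^sub>R chi x"
    and homeo: "homeomorphic_map (top_of_set (sa UNIV)) (top_of_set (aff_dual L)) chi"
    using assms(1) unfolding regularly_embedded_def Let_def L_def by blast
  (* The constant function 1 on L, as an element of the space of affine functions. *)
  define a :: "'v \<Rightarrow> real" where "a x = (if x \<in> L then 1 else 0)" for x
  have "continuous_on L a"
    by (rule continuous_on_eq[of _ "\<lambda>_. 1"]) (simp_all add: a_def)
  moreover have "affine_map_on L a"
    using L by (simp add: affine_map_on_def a_def convex_alt)
  ultimately have a: "a \<in> aff_sa L"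
    by (simp add: aff_sa_def a_def)
  have "continuous_on (sa UNIV) chi"
    using homeomorphic_imp_continuous_map[OF homeo] by simp
  then have "continuous_on (sa UNIV) (\<lambda>x. chi x a)"
    by (rule continuous_on_product_then_coordinatewise)
  then obtain f :: "'v \<Rightarrow> complex" where f: "Vector_Spaces.linear scaleC scaleC f"
    "continuous_on UNIV f" "\<And>x. x \<in> sa UNIV \<Longrightarrow> f x = complex_of_real (chi x a)"
    using complexify_real_functional[of "\<lambda>x. chi x a"] by (auto simp: add scale scaleR_fun_def)
  have "f x = 1" if "x \<in> L" for x
  proof -
    have "x \<in> sa UNIV"
      using that sa by (auto simp: L_def lead_def)
    moreover have "chi x a = 1"
      using chi[OF that that _ _ a, of 1 0] that by (simp add: a_def)
    ultimately show ?thesis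
      by (simp add: f(3))
  qed
  with f(1,2) that show thesis
    unfolding L_def by blast
qed

theorem theorem5p4:
  fixes K :: "nat \<Rightarrow> (nat \<Rightarrow> nat \<Rightarrow> 'v::star_locally_convex) set"
  assumes "L1_matrix_convex K"
    and "\<And>n. n \<ge> 1 \<Longrightarrow> cone_in (mats_sa UNIV n) (cap_cone K n)"
    and "proper_cone (entries1 (cap_cone K 1))"
    and "generating (entries1 (cap_cone K 1))"
    and "regularly_embedded K"
    and "L1_matricial_cap K"
  shows "\<exists>e. matrix_order_unit_space (A0 K) (A0_cone K) e"
proof -
  have K1: "K 1 \<subseteq> mats_sa UNIV 1" "compact (K 1)" "convex (K 1)" "0 \<in> K 1"
    using assms(1)[unfolded L1_matrix_convex_def, THEN conjunct1, rule_format, of 1]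
    by (simp_all add: extreme_point_of_def)
  have sa: "entries1 (K 1) \<subseteq> sa UNIV"
  proof
    fix x assume "x \<in> entries1 (K 1)"
    then obtain u where "u \<in> mats_sa UNIV 1" "x = u 0 0"
      using K1(1) by (auto simp: entries1_def)
    then have "mstar u 0 0 = u 0 0" "x = u 0 0"
      by (simp_all add: mats_sa_def)
    then show "x \<in> sa UNIV"
      by (simp add: mstar_def sa_def)
  qed
  have "continuous_on (K 1) (\<lambda>u. u 0 0)"
    by (rule continuous_on_product_then_coordinatewise[OF
          continuous_on_product_then_coordinatewise[OF continuous_on_id]])
  then have compact: "compact (entries1 (K 1))"
    unfolding entries1_def using K1(2) by (rule compact_continuous_image)
  interpret spanning_base K
  proof
    show "entries1 (K 1) \<subseteq> sa UNIV" by (rule sa)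
    show "0 \<in> entries1 (K 1)"
      unfolding entries1_def using K1(4) by (rule rev_image_eqI) simp
    have "linear (\<lambda>u :: nat \<Rightarrow> nat \<Rightarrow> 'v. u 0 0)"
      by (rule linearI) (simp_all add: scaleR_fun_def)
    then show "convex (entries1 (K 1))"
      unfolding entries1_def using K1(3) by (rule convex_linear_image)
    have "entries1 (cap_cone K 1) \<subseteq> scaleC.span (entries1 (K 1))"
    proof
      fix x assume "x \<in> entries1 (cap_cone K 1)"
      then obtain r u where "u \<in> K 1" "x = (real r *\<^sub>R u) 0 0"
        by (auto simp: entries1_def cap_cone_def)
      then have "u 0 0 \<in> entries1 (K 1)" "x = complex_of_real (real r) *\<^sub>C u 0 0"
        by (auto simp: entries1_def scaleR_matrix_entry)
      then show "x \<in> scaleC.span (entries1 (K 1))"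
        using scaleC.span_scale scaleC.span_base by blast
    qed
    then have "scaleC.span (entries1 (cap_cone K 1)) \<subseteq> scaleC.span (entries1 (K 1))"
      by (intro scaleC.span_minimal scaleC.subspace_span)
    then show "scaleC.span (entries1 (K 1)) = UNIV"
      using assms(4) by (auto simp: generating_def)
  qed
  obtain f :: "'v \<Rightarrow> complex" where "Vector_Spaces.linear scaleC scaleC f"
    "continuous_on UNIV f" "\<And>x. x \<in> lead (entries1 (K 1)) \<Longrightarrow> f x = 1"
    using regularly_embedded_unit_functional[OF assms(5) sa] by blast
  note unit = order_unit_if_one_on_lead[OF compact this]
  have "compress m \<gamma> ` A0_cone K m \<subseteq> A0_cone K n"
    if "m \<ge> 1" "n \<ge> 1" "\<gamma> \<in> mats UNIV m n" for m n \<gamma>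
  proof -
    have "(\<lambda>j k. \<gamma> k j) \<in> mats UNIV n m"
      using that(3) by (auto simp: mats_def)
    then show ?thesis
      using A0_cone_compress[OF _ that(3)] L1_matrix_convex_absorbs_compress[OF assms(1) that(2,1)]
      by blast
  qed
  then have "matrix_ordered (A0 K) (A0_cone K)"
    by (simp add: matrix_ordered_def A0_star_subspace A0_cone_cone_in)
  with unit show ?thesis
    unfolding matrix_order_unit_space_def using A0_cone_proper A0_cone_archimedean by blast
qed

end
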